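(* Let $P$ be a Borel probability measure on $\mathbb{R}_+$ with finite mean $\mu\neq0$. Assume that the (random or deterministic) vectors $\mathbf{w}^{(n)}=(w_1^{(n)},\ldots,w_n^{(n)})$, $n\in\mathbb{N}$, of nonnegative real numbers satisfy condition LLN-$P$ (defined in the context), and let $\mathbf{p}^{(n)}=(p_i^{(n)})_{i=1}^n$ be defined by $$p_i^{(n)}=\frac{w_i^{(n)}}{\sum_{j=1}^nw_j^{(n)}},\qquad i=1,\ldots,n.$$ Then the empirical measure $$\nu^{(n)}:=\frac1n\sum_{i=1}^n\delta_{n\mu p_i^{(n)}}$$ converges in law, as $n\to\infty$, to the deterministic limit $P$.
   Context: The convention $0/0:=0$ is used. $\delta_x$ is the Dirac mass at $x$. Random probability measures are regarded as random elements of the Polish space $\mathcal{P}(\mathbb{R}_+)$ of Borel probability measures on $\mathbb{R}_+=[0,\infty)$ with the weak topology. Condition LLN-$P$: there exist positive random variables $Z_n$ (with $Z_n$ defined on the same probability space as $\mathbf{w}^{(n)}$) such that the empirical measures $\hat\nu^{(n)}:=\frac1n\sum_{i=1}^n\delta_{Z_nw_i^{(n)}}$ converge in law to the deterministic limit $P$, and their empirical means $\frac1n\sum_{i=1}^nZ_nw_i^{(n)}$ converge in law to $\mu=\int xP(dx)\in(0,\infty)$. *)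

theory Defs
  imports "HOL-Probability.Probability"
begin

text \<open>
  The coarsest topology on the Borel probability measures on \<open>S\<close> (carrying the subspace
  topology) that makes \<open>N \<mapsto> \<integral>f dN\<close> continuous for every bounded continuous real function
  \<open>f\<close> on \<open>S\<close>.
\<close>

definition weak_topology :: "'a::topological_space set \<Rightarrow> 'a measure topology" where
  "weak_topology S = topology_generated_by
     {{N \<in> space (prob_algebra (restrict_space borel S)). (\<integral>x. f x \<partial>N) \<in> U} | f U.
        continuous_on S (f :: 'a \<Rightarrow> real) \<and> bounded (f ` S) \<and> open U}"

lemma topspace_weak_topology:
  "topspace (weak_topology S) =
     {N. prob_space N \<and> sets N = sets (restrict_space borel S)}"
proof -
  let ?PS = "space (prob_algebra (restrict_space borel S))"
  let ?\<B> = "{{N \<in> ?PS. (\<integral>x. f x \<partial>N) \<in> U} | f U.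
    continuous_on S (f :: 'a \<Rightarrow> real) \<and> bounded (f ` S) \<and> open U}"
  have "bounded ((\<lambda>_. 0 :: real) ` S)"
    by (rule bounded_subset[of "{0}"]) auto
  then have "{N \<in> ?PS. (\<integral>x. 0 \<partial>N) \<in> (UNIV :: real set)} \<in> ?\<B>"
    by (intro CollectI exI[of _ "\<lambda>_. 0"] exI[of _ UNIV] conjI refl continuous_on_const open_UNIV)
  then have "?PS \<in> ?\<B>"
    by simp
  then have "?PS \<subseteq> \<Union>?\<B>"
    by (rule Union_upper)
  moreover have "\<Union>?\<B> \<subseteq> ?PS"
    by (rule Union_least) blast
  ultimately have "topspace (weak_topology S) = ?PS"
    unfolding weak_topology_def topology_generated_by_topspace by (rule equalityI[rotated])
  then show ?thesis
    by (simp add: space_prob_algebra Collect_conv_if conj_commute)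
qed

definition borel_sigma :: "'a topology \<Rightarrow> 'a measure" where
  "borel_sigma T = sigma (topspace T) {U. openin T U}"

lemma space_borel_sigma [simp]: "space (borel_sigma T) = topspace T"
  unfolding borel_sigma_def by (intro space_measure_of) (auto dest: openin_subset)

text \<open>
  The random elements \<open>X n\<close> are indexed by \<open>n \<ge> 1\<close>, each living on its own probability space
  \<open>M n\<close>; \<open>Q\<close> is the law of the limit.
\<close>

definition converges_in_law ::
  "'b topology \<Rightarrow> (nat \<Rightarrow> 'a measure) \<Rightarrow> (nat \<Rightarrow> 'a \<Rightarrow> 'b) \<Rightarrow> 'b measure \<Rightarrow> bool" where
  "converges_in_law T M X Q \<longleftrightarrow>
     (\<forall>n\<ge>1. X n \<in> M n \<rightarrow>\<^sub>M borel_sigma T) \<and>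
     prob_space Q \<and> sets Q = sets (borel_sigma T) \<and>
     (\<forall>F. continuous_map T euclideanreal F \<and> bounded (F ` topspace T) \<longrightarrow>
        (\<lambda>n. \<integral>\<omega>. F (X n \<omega>) \<partial>M n) \<longlonglongrightarrow> (\<integral>y. F y \<partial>Q))"

definition converges_in_law_to_const ::
  "'b topology \<Rightarrow> (nat \<Rightarrow> 'a measure) \<Rightarrow> (nat \<Rightarrow> 'a \<Rightarrow> 'b) \<Rightarrow> 'b \<Rightarrow> bool" where
  "converges_in_law_to_const T M X c \<longleftrightarrow>
     c \<in> topspace T \<and> converges_in_law T M X (return (borel_sigma T) c)"

definition nonneg_borel :: "real measure" where
  "nonneg_borel = restrict_space borel {0..}"

lemma space_nonneg_borel [simp]: "space nonneg_borel = {0..}"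
  by (simp add: nonneg_borel_def space_restrict_space)

definition empirical_measure :: "nat \<Rightarrow> (nat \<Rightarrow> real) \<Rightarrow> real measure" where
  "empirical_measure n x = measure_of (space nonneg_borel) (sets nonneg_borel)
     (\<lambda>A. ennreal (1 / real n) * (\<Sum>i=1..n. emeasure (return nonneg_borel (x i)) A))"

lemma sets_empirical_measure [simp]: "sets (empirical_measure n x) = sets nonneg_borel"
  unfolding empirical_measure_def by (rule sets.sets_measure_of_eq)

lemma emeasure_empirical_measure:
  assumes "A \<in> sets nonneg_borel"
  shows "emeasure (empirical_measure n x) A =
    ennreal (1 / real n) * (\<Sum>i=1..n. emeasure (return nonneg_borel (x i)) A)"
proof (rule emeasure_measure_of[OF empirical_measure_def])
  show "sets nonneg_borel \<subseteq> Pow (space nonneg_borel)"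
    by (rule sets.space_closed)
  show "A \<in> sets (empirical_measure n x)"
    using assms by simp
  show "positive (sets (empirical_measure n x))
     (\<lambda>A. ennreal (1 / real n) * (\<Sum>i=1..n. emeasure (return nonneg_borel (x i)) A))"
    by (simp add: positive_def)
  show "countably_additive (sets (empirical_measure n x))
     (\<lambda>A. ennreal (1 / real n) * (\<Sum>i=1..n. emeasure (return nonneg_borel (x i)) A))"
  proof (rule countably_additiveI)
    fix A :: "nat \<Rightarrow> real set"
    assume A: "range A \<subseteq> sets (empirical_measure n x)" "disjoint_family A"
    have "(\<Sum>k. \<Sum>i=1..n. emeasure (return nonneg_borel (x i)) (A k)) =
        (\<Sum>i=1..n. \<Sum>k. emeasure (return nonneg_borel (x i)) (A k))"
      by (intro suminf_sum) auto
    also have "\<dots> = (\<Sum>i=1..n. emeasure (return nonneg_borel (x i)) (\<Union>k. A k))"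
      using A by (intro sum.cong refl suminf_emeasure) auto
    finally show "(\<Sum>k. ennreal (1 / real n) *
          (\<Sum>i=1..n. emeasure (return nonneg_borel (x i)) (A k))) =
        ennreal (1 / real n) * (\<Sum>i=1..n. emeasure (return nonneg_borel (x i)) (\<Union>k. A k))"
      by simp
  qed
qed

lemma empirical_measure_in_topspace:
  assumes "n \<ge> 1" and "\<And>i. i \<in> {1..n} \<Longrightarrow> x i \<ge> 0"
  shows "empirical_measure n x \<in> topspace (weak_topology {0..})"
proof -
  have sp: "space (empirical_measure n x) = space nonneg_borel"
    by (rule sets_eq_imp_space_eq) simp
  have "emeasure (empirical_measure n x) (space nonneg_borel) =
      ennreal (1 / real n) * (\<Sum>i=1..n. emeasure (return nonneg_borel (x i)) (space nonneg_borel))"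
    by (rule emeasure_empirical_measure) (rule sets.top)
  also have "(\<Sum>i=1..n. emeasure (return nonneg_borel (x i)) (space nonneg_borel)) = (\<Sum>i=1..n. 1)"
  proof (rule sum.cong[OF refl])
    fix i assume "i \<in> {1..n}"
    then have "x i \<in> space nonneg_borel"
      using assms(2) by simp
    then show "emeasure (return nonneg_borel (x i)) (space nonneg_borel) = 1"
      by (subst emeasure_return[OF sets.top]) (simp only: indicator_simps)
  qed
  also have "ennreal (1 / real n) * (\<Sum>i=1..n. 1) = 1"
    using assms(1) by (simp add: ennreal_of_nat_eq_real_of_nat flip: ennreal_mult)
  finally have "prob_space (empirical_measure n x)"
    by (intro prob_spaceI) (simp only: sp)
  then show ?thesis
    by (simp add: topspace_weak_topology flip: nonneg_borel_def)
qed

text \<open>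
  The entries of the \<open>n\<close>-th vector are \<open>w n 1, \<dots>, w n n\<close>, random variables on \<open>M n\<close>.
  Convergence in law of the real-valued empirical means is \<^const>\<open>weak_conv_m\<close> for their laws.
\<close>

definition LLN_condition ::
  "(nat \<Rightarrow> 'a measure) \<Rightarrow> (nat \<Rightarrow> nat \<Rightarrow> 'a \<Rightarrow> real) \<Rightarrow> real measure \<Rightarrow> bool" where
  "LLN_condition M w P \<longleftrightarrow>
     integrable P (\<lambda>x. x) \<and> 0 < (\<integral>x. x \<partial>P) \<and>
     (\<exists>Z :: nat \<Rightarrow> 'a \<Rightarrow> real.
        (\<forall>n\<ge>1. Z n \<in> borel_measurable (M n) \<and> (\<forall>\<omega>\<in>space (M n). 0 < Z n \<omega>)) \<and>
        converges_in_law_to_const (weak_topology {0..}) M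
          (\<lambda>n \<omega>. empirical_measure n (\<lambda>i. Z n \<omega> * w n i \<omega>)) P \<and>
        weak_conv_m
          (\<lambda>n. distr (M n) borel (\<lambda>\<omega>. (1 / real n) * (\<Sum>i=1..n. Z n \<omega> * w n i \<omega>)))
          (return borel (\<integral>x. x \<partial>P)))"

end

theory Submission
  imports Defs
begin

text \<open>
  Write \<open>x\<^sub>i = Z\<^sub>n w\<^sub>i\<close> and \<open>m = (1/n) \<Sum>\<^sub>i x\<^sub>i\<close>. The unknown factor \<open>Z\<^sub>n\<close> cancels in the proportions,
  so \<open>n \<mu> p\<^sub>i = (\<mu> / m) x\<^sub>i\<close>: the measure \<open>\<nu>\<close> is the empirical measure \<open>\<nu>'\<close> of the \<open>x\<^sub>i\<close>
  dilated by \<open>\<mu> / m\<close>. Since \<open>m\<close> tends to \<open>\<mu>\<close> in probability, the dilation factor tends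
  to \<open>1\<close>, and it remains to see that such a dilation changes the integral of a bounded
  continuous test function only slightly.

  Continuity of \<open>f\<close> controls \<open>f (c x) - f x\<close> only for \<open>x\<close> in a bounded interval \<open>[0, K]\<close>.
  The mass of \<open>\<nu>'\<close> outside that interval is at most \<open>m / K\<close> by Markov's inequality, and \<open>m\<close> is
  close to \<open>\<mu>\<close>; the convergence of the means thus provides all the tightness needed. The two
  effects are combined pointwise in \<open>dilation_bound\<close> and averaged in \<open>normalisation_bound\<close>,
  which is a deterministic statement about finite sequences.

  The passage between laws and probabilities rests on the fact that convergence in law to a
  constant \<open>P\<close> in the weak topology is convergence in probability of \<open>\<integral>f d\<nu>\<close> to
  \<open>\<integral>f dP\<close> for every bounded continuous \<open>f\<close>. One direction is Markov's inequality
  (\<open>converges_in_law_to_const_imp_in_prob\<close>). For the other, the sets of measures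
  with \<open>\<integral>f dN \<in> U\<close> form a subbase, so the probability of missing an open neighbourhood of
  \<open>P\<close> tends to zero (\<open>in_prob_imp_converges_in_law_to_const_weak_topology\<close>). That the empirical measures are Borel random elements
  follows from the continuity of \<open>x \<mapsto> (1/n) \<Sum>\<^sub>i \<delta>\<^bsub>x\<^sub>i\<^esub>\<close>.
\<close>

section \<open>The weak topology and its Borel sets\<close>

lemma openin_in_borel_sigma:
  assumes "openin T U"
  shows "U \<in> sets (borel_sigma T)"
  unfolding borel_sigma_def using assms openin_subset by (subst sets_measure_of) auto

lemma continuous_map_measurable_borel_sigma_euclidean:
  assumes "continuous_map euclidean T E"
  shows "E \<in> borel \<rightarrow>\<^sub>M borel_sigma T"
  unfolding borel_sigma_def
proof (rule measurable_measure_of)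
  show "{U. openin T U} \<subseteq> Pow (topspace T)"
    using openin_subset by auto
  show "E \<in> space borel \<rightarrow> topspace T"
    using assms by (auto simp: continuous_map_def)
  fix U assume "U \<in> {U. openin T U}"
  then have "openin euclidean {x \<in> topspace euclidean. E x \<in> U}"
    using openin_continuous_map_preimage[OF assms] by simp
  then show "E -` U \<inter> space borel \<in> sets borel"
    by (simp add: vimage_def flip: open_openin)
qed

lemma continuous_map_measurable_borel_sigma:
  assumes "continuous_map T euclideanreal F"
  shows "F \<in> borel_sigma T \<rightarrow>\<^sub>M borel"
proof (rule borel_measurableI)
  fix U :: "real set" assume "open U"
  then have "openin T {x \<in> topspace T. F x \<in> U}"
    using assms by (simp add: continuous_map_def)
  moreover have "F -` U \<inter> space (borel_sigma T) = {x \<in> topspace T. F x \<in> U}"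
    by auto
  ultimately show "F -` U \<inter> space (borel_sigma T) \<in> sets (borel_sigma T)"
    by (simp add: openin_in_borel_sigma)
qed

lemma continuous_map_integral_weak_topology:
  fixes f :: "'a::topological_space \<Rightarrow> real"
  assumes "continuous_on S f" "bounded (f ` S)"
  shows "continuous_map (weak_topology S) euclideanreal (\<lambda>N. \<integral>x. f x \<partial>N)"
  unfolding continuous_map_def
proof (intro conjI allI impI)
  fix U :: "real set" assume "openin euclideanreal U"
  then have "openin (weak_topology S)
      {N \<in> space (prob_algebra (restrict_space borel S)). (\<integral>x. f x \<partial>N) \<in> U}"
    unfolding weak_topology_def using assms
    by (intro topology_generated_by_Basis) auto
  then show "openin (weak_topology S) {N \<in> topspace (weak_topology S). (\<integral>x. f x \<partial>N) \<in> U}"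
    by (simp add: topspace_weak_topology space_prob_algebra conj_commute)
qed simp

section \<open>Convergence in law to a constant as convergence in probability\<close>

lemma measure_tendsto_zero:
  assumes "g \<longlonglongrightarrow> 0" "\<forall>\<^sub>F n in sequentially. measure (M n) (A n) \<le> g n"
  shows "(\<lambda>n. measure (M n) (A n)) \<longlonglongrightarrow> 0"
  by (rule tendsto_sandwich[OF _ assms(2) tendsto_const assms(1)]) simp

text \<open>
  The function \<open>min \<epsilon> \<bar>F - F c\<bar>\<close> is bounded and continuous and vanishes at \<open>c\<close>, so its expectation
  tends to zero and Markov's inequality applies. The cap at \<open>\<epsilon>\<close> makes it an admissible test
  function and leaves the event \<open>\<epsilon> \<le> \<bar>F - F c\<bar>\<close> unchanged.
\<close>

lemma converges_in_law_to_const_imp_in_prob: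
  assumes conv: "converges_in_law_to_const T M X c"
    and prob: "\<And>n. n \<ge> 1 \<Longrightarrow> prob_space (M n)"
    and F: "continuous_map T euclideanreal F" and "\<epsilon> > 0"
  shows "(\<lambda>n. measure (M n) {\<omega> \<in> space (M n). \<epsilon> \<le> \<bar>F (X n \<omega>) - F c\<bar>}) \<longlonglongrightarrow> 0"
proof -
  define G where "G y = min \<epsilon> \<bar>F y - F c\<bar>" for y
  have c: "c \<in> topspace T" and X: "\<And>n. n \<ge> 1 \<Longrightarrow> X n \<in> M n \<rightarrow>\<^sub>M borel_sigma T"
    using conv by (auto simp: converges_in_law_to_const_def converges_in_law_def)
  have G: "continuous_map T euclideanreal G"
    unfolding G_def by (intro continuous_intros F)
  have G_meas: "G \<in> borel_sigma T \<rightarrow>\<^sub>M borel"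
    by (rule continuous_map_measurable_borel_sigma[OF G])
  have G_bound: "0 \<le> G y" "G y \<le> \<epsilon>" "\<bar>G y\<bar> \<le> \<epsilon>" for y
    using \<open>\<epsilon> > 0\<close> by (auto simp: G_def)
  have "bounded (G ` topspace T)"
    using G_bound by (intro boundedI[of _ \<epsilon>]) auto
  with G conv have "(\<lambda>n. \<integral>\<omega>. G (X n \<omega>) \<partial>M n) \<longlonglongrightarrow> (\<integral>y. G y \<partial>return (borel_sigma T) c)"
    by (auto simp: converges_in_law_to_const_def converges_in_law_def)
  also have "(\<integral>y. G y \<partial>return (borel_sigma T) c) = 0"
    using c G_meas \<open>\<epsilon> > 0\<close> by (subst integral_return) (auto simp: G_def)
  finally have "(\<lambda>n. (\<integral>\<omega>. G (X n \<omega>) \<partial>M n) / \<epsilon>) \<longlonglongrightarrow> 0"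
    by (rule tendsto_divide_zero)
  moreover have "\<forall>\<^sub>F n in sequentially.
      measure (M n) {\<omega> \<in> space (M n). \<epsilon> \<le> \<bar>F (X n \<omega>) - F c\<bar>} \<le> (\<integral>\<omega>. G (X n \<omega>) \<partial>M n) / \<epsilon>"
    using eventually_ge_at_top[of 1]
  proof eventually_elim
    case (elim n)
    interpret prob_space "M n" by (rule prob[OF elim])
    have "integrable (M n) (\<lambda>\<omega>. G (X n \<omega>))"
      using G_bound by (intro integrable_const_bound[of _ \<epsilon>] AE_I2 measurable_compose[OF X[OF elim] G_meas])
        auto
    then have "measure (M n) {\<omega> \<in> space (M n). \<epsilon> \<le> G (X n \<omega>)} \<le> (\<integral>\<omega>. G (X n \<omega>) \<partial>M n) / \<epsilon>"
      using G_bound \<open>\<epsilon> > 0\<close> by (intro integral_Markov_inequality_measure[of _ _ "{}"]) auto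
    then show ?case
      by (simp add: G_def)
  qed
  ultimately show ?thesis
    by (rule measure_tendsto_zero)
qed

text \<open>
  Given a bounded continuous \<open>F\<close>, its values are close to \<open>F c\<close> on an open neighbourhood of \<open>c\<close>;
  outside of it, the bound on \<open>F\<close> is multiplied by a vanishing probability.
\<close>

lemma converges_in_law_to_constI:
  assumes prob: "\<And>n. n \<ge> 1 \<Longrightarrow> prob_space (M n)"
    and X: "\<And>n. n \<ge> 1 \<Longrightarrow> X n \<in> M n \<rightarrow>\<^sub>M borel_sigma T"
    and c: "c \<in> topspace T"
    and nbhd: "\<And>U. openin T U \<Longrightarrow> c \<in> U \<Longrightarrow>
      (\<lambda>n. measure (M n) {\<omega> \<in> space (M n). X n \<omega> \<notin> U}) \<longlonglongrightarrow> 0"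
  shows "converges_in_law_to_const T M X c"
  unfolding converges_in_law_to_const_def converges_in_law_def
proof (intro conjI allI impI)
  show "prob_space (return (borel_sigma T) c)"
    using c by (intro prob_space_return) simp
  fix F :: "'b \<Rightarrow> real"
  assume "continuous_map T euclideanreal F \<and> bounded (F ` topspace T)"
  then have F: "continuous_map T euclideanreal F" and "bounded (F ` topspace T)"
    by auto
  then obtain B where "B > 0" and B: "\<And>y. y \<in> topspace T \<Longrightarrow> \<bar>F y\<bar> \<le> B"
    unfolding bounded_pos by auto
  have F_meas: "F \<in> borel_sigma T \<rightarrow>\<^sub>M borel"
    by (rule continuous_map_measurable_borel_sigma[OF F])
  have "(\<lambda>n. \<integral>\<omega>. F (X n \<omega>) \<partial>M n) \<longlonglongrightarrow> F c"
  proof (rule tendstoI)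
    fix e :: real assume "e > 0"
    define U where "U = {y \<in> topspace T. F y \<in> ball (F c) (e / 2)}"
    have U: "openin T U"
      unfolding U_def by (rule openin_continuous_map_preimage[OF F]) simp
    have "c \<in> U"
      using c \<open>e > 0\<close> by (simp add: U_def)
    have "(\<lambda>n. e / 2 + 2 * B * measure (M n) {\<omega> \<in> space (M n). X n \<omega> \<notin> U}) \<longlonglongrightarrow> e / 2 + 2 * B * 0"
      by (intro tendsto_intros nbhd U \<open>c \<in> U\<close>)
    then have "\<forall>\<^sub>F n in sequentially.
        e / 2 + 2 * B * measure (M n) {\<omega> \<in> space (M n). X n \<omega> \<notin> U} < e"
      by (rule order_tendstoD(2)) (use \<open>e > 0\<close> in simp)
    then show "\<forall>\<^sub>F n in sequentially. dist (\<integral>\<omega>. F (X n \<omega>) \<partial>M n) (F c) < e"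
      using eventually_ge_at_top[of 1]
    proof eventually_elim
      case (elim n)
      interpret prob_space "M n" by (rule prob[OF elim(2)])
      have X_top: "X n \<omega> \<in> topspace T" if "\<omega> \<in> space (M n)" for \<omega>
        using measurable_space[OF X[OF elim(2)] that] by simp
      define A where "A = {\<omega> \<in> space (M n). X n \<omega> \<notin> U}"
      have "A = X n -` (topspace T - U) \<inter> space (M n)"
        using X_top by (auto simp: A_def)
      moreover have "topspace T - U \<in> sets (borel_sigma T)"
        using sets.compl_sets[OF openin_in_borel_sigma[OF U]] by simp
      ultimately have A[measurable]: "A \<in> sets (M n)"
        using measurable_sets[OF X[OF elim(2)]] by simp
      have FX[measurable]: "(\<lambda>\<omega>. F (X n \<omega>)) \<in> borel_measurable (M n)"
        by (rule measurable_compose[OF X[OF elim(2)] F_meas])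
      have int: "integrable (M n) (\<lambda>\<omega>. F (X n \<omega>))"
        using B X_top by (intro integrable_const_bound[of _ B]) auto
      have pw: "\<bar>F (X n \<omega>) - F c\<bar> \<le> e / 2 + 2 * B * indicator A \<omega>" if "\<omega> \<in> space (M n)" for \<omega>
      proof (cases "X n \<omega> \<in> U")
        case True
        then show ?thesis
          using \<open>B > 0\<close> by (simp add: U_def dist_real_def abs_minus_commute A_def)
      next
        case False
        then have "indicator A \<omega> = (1 :: real)"
          using that by (simp add: A_def)
        then show ?thesis
          using B[OF X_top[OF that]] B[OF c] \<open>e > 0\<close> by simp
      qed
      have "\<bar>(\<integral>\<omega>. F (X n \<omega>) \<partial>M n) - F c\<bar> = \<bar>\<integral>\<omega>. F (X n \<omega>) - F c \<partial>M n\<bar>"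
        using int by (simp add: prob_space)
      also have "\<dots> \<le> (\<integral>\<omega>. \<bar>F (X n \<omega>) - F c\<bar> \<partial>M n)"
        by (rule integral_abs_bound)
      also have "\<dots> \<le> (\<integral>\<omega>. e / 2 + 2 * B * indicator A \<omega> \<partial>M n)"
        using int pw by (intro integral_mono) (auto simp: less_top[symmetric])
      also have "\<dots> = e / 2 + 2 * B * measure (M n) A"
        by (simp add: prob_space less_top[symmetric])
      also have "\<dots> < e"
        using elim(1) by (simp add: A_def)
      finally show ?case
        by (simp add: dist_real_def)
    qed
  qed
  also have "F c = (\<integral>y. F y \<partial>return (borel_sigma T) c)"
    using c F_meas by (subst integral_return) auto
  finally show "(\<lambda>n. \<integral>\<omega>. F (X n \<omega>) \<partial>M n) \<longlonglongrightarrow> (\<integral>y. F y \<partial>return (borel_sigma T) c)" .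
qed (use X c in auto)

text \<open>
  The open sets \<open>U\<close> for which \<open>P \<in> U\<close> forces the probability of \<open>X n \<notin> U\<close> to vanish are stable
  under finite intersections, by subadditivity, and arbitrary unions, by monotonicity. Hence it
  suffices to treat the generating sets, where the hypothesis applies directly.
\<close>

lemma in_prob_imp_converges_in_law_to_const_weak_topology:
  fixes P :: "'b::topological_space measure"
  assumes prob: "\<And>n. n \<ge> 1 \<Longrightarrow> prob_space (M n)"
    and X: "\<And>n. n \<ge> 1 \<Longrightarrow> X n \<in> M n \<rightarrow>\<^sub>M borel_sigma (weak_topology S)"
    and P: "P \<in> topspace (weak_topology S)"
    and lim: "\<And>(f :: 'b \<Rightarrow> real) \<epsilon>. continuous_on S f \<Longrightarrow> bounded (f ` S) \<Longrightarrow> \<epsilon> > 0 \<Longrightarrow>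
      (\<lambda>n. measure (M n)
        {\<omega> \<in> space (M n). \<epsilon> \<le> \<bar>(\<integral>x. f x \<partial>X n \<omega>) - (\<integral>x. f x \<partial>P)\<bar>}) \<longlonglongrightarrow> 0"
  shows "converges_in_law_to_const (weak_topology S) M X P"
proof (rule converges_in_law_to_constI[OF prob X P])
  let ?T = "weak_topology S"
  let ?\<B> = "{{N \<in> space (prob_algebra (restrict_space borel S)). (\<integral>x. f x \<partial>N) \<in> U} | f U.
        continuous_on S (f :: 'b \<Rightarrow> real) \<and> bounded (f ` S) \<and> open U}"
  have meas: "{\<omega> \<in> space (M n). X n \<omega> \<notin> U} \<in> sets (M n)" if "n \<ge> 1" "openin ?T U" for n U
  proof -
    have "{\<omega> \<in> space (M n). X n \<omega> \<notin> U} = space (M n) - (X n -` U \<inter> space (M n))"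
      by auto
    then show ?thesis
      using measurable_sets[OF X[OF that(1)] openin_in_borel_sigma[OF that(2)]] by simp
  qed
  fix U assume "openin ?T U" "P \<in> U"
  from \<open>openin ?T U\<close> have "generate_topology_on ?\<B> U"
    unfolding weak_topology_def by (rule openin_topology_generated_by)
  then show "(\<lambda>n. measure (M n) {\<omega> \<in> space (M n). X n \<omega> \<notin> U}) \<longlonglongrightarrow> 0"
    using \<open>P \<in> U\<close>
  proof (induction rule: generate_topology_on.induct)
    case Empty
    then show ?case by simp
  next
    case (Int a b)
    then have open_ab: "openin ?T a" "openin ?T b"
      by (simp_all add: weak_topology_def openin_topology_generated_by_iff)
    have "(\<lambda>n. measure (M n) {\<omega> \<in> space (M n). X n \<omega> \<notin> a} +
        measure (M n) {\<omega> \<in> space (M n). X n \<omega> \<notin> b}) \<longlonglongrightarrow> 0"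
      using Int by (intro tendsto_add_zero) auto
    moreover have "\<forall>\<^sub>F n in sequentially. measure (M n) {\<omega> \<in> space (M n). X n \<omega> \<notin> a \<inter> b} \<le>
        measure (M n) {\<omega> \<in> space (M n). X n \<omega> \<notin> a} + measure (M n) {\<omega> \<in> space (M n). X n \<omega> \<notin> b}"
      using eventually_ge_at_top[of 1]
    proof eventually_elim
      case (elim n)
      interpret prob_space "M n" by (rule prob[OF elim])
      have "{\<omega> \<in> space (M n). X n \<omega> \<notin> a \<inter> b} =
          {\<omega> \<in> space (M n). X n \<omega> \<notin> a} \<union> {\<omega> \<in> space (M n). X n \<omega> \<notin> b}"
        by auto
      then show ?case
        using elim open_ab by (simp add: measure_Un_le meas)
    qed
    ultimately show ?case
      by (rule measure_tendsto_zero)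
  next
    case (UN K)
    then obtain k where k: "k \<in> K" "P \<in> k"
      by auto
    have open_K: "openin ?T k'" if "k' \<in> K" for k'
      using UN(1)[OF that] by (simp add: weak_topology_def openin_topology_generated_by_iff)
    have "\<forall>\<^sub>F n in sequentially. measure (M n) {\<omega> \<in> space (M n). X n \<omega> \<notin> \<Union>K} \<le>
        measure (M n) {\<omega> \<in> space (M n). X n \<omega> \<notin> k}"
      using eventually_ge_at_top[of 1]
    proof eventually_elim
      case (elim n)
      interpret prob_space "M n" by (rule prob[OF elim])
      show ?case
        using k elim by (intro finite_measure_mono meas open_K) auto
    qed
    then show ?case
      by (rule measure_tendsto_zero[OF UN(2)[OF k]])
  next
    case (Basis s)
    then obtain f V where f: "continuous_on S (f :: 'b \<Rightarrow> real)" "bounded (f ` S)" and "open V"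
      and s: "s = {N \<in> space (prob_algebra (restrict_space borel S)). (\<integral>x. f x \<partial>N) \<in> V}"
      by blast
    with Basis obtain \<epsilon> where "\<epsilon> > 0" and \<epsilon>: "ball (\<integral>x. f x \<partial>P) \<epsilon> \<subseteq> V"
      by (auto simp: open_contains_ball)
    let ?d = "\<lambda>n \<omega>. \<bar>(\<integral>x. f x \<partial>X n \<omega>) - (\<integral>x. f x \<partial>P)\<bar>"
    have "\<forall>\<^sub>F n in sequentially. measure (M n) {\<omega> \<in> space (M n). X n \<omega> \<notin> s} \<le>
        measure (M n) {\<omega> \<in> space (M n). \<epsilon> \<le> ?d n \<omega>}"
      using eventually_ge_at_top[of 1]
    proof eventually_elim
      case (elim n)
      interpret prob_space "M n" by (rule prob[OF elim])
      have "(\<lambda>\<omega>. \<integral>x. f x \<partial>X n \<omega>) \<in> borel_measurable (M n)"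
        by (rule measurable_compose[OF X[OF elim]
              continuous_map_measurable_borel_sigma[OF continuous_map_integral_weak_topology[OF f]]])
      then have *: "{\<omega> \<in> space (M n). \<epsilon> \<le> ?d n \<omega>} \<in> sets (M n)"
        by measurable
      have "\<epsilon> \<le> ?d n \<omega>" if "\<omega> \<in> space (M n)" "X n \<omega> \<notin> s" for \<omega>
      proof (rule ccontr)
        assume "\<not> \<epsilon> \<le> ?d n \<omega>"
        then have "(\<integral>x. f x \<partial>X n \<omega>) \<in> V"
          by (intro subsetD[OF \<epsilon>]) (simp add: dist_real_def abs_minus_commute)
        then show False
          using that measurable_space[OF X[OF elim] that(1)]
          by (auto simp: s topspace_weak_topology space_prob_algebra)
      qed
      then show ?case
        by (intro finite_measure_mono *) auto
    qed
    then show ?case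
      by (rule measure_tendsto_zero[OF lim[OF f \<open>\<epsilon> > 0\<close>]])
  qed
qed

section \<open>Empirical measures\<close>

text \<open>
  As the image of the uniform distribution on the indices, an empirical measure inherits the
  formula for integrals from the change of variables theorem.
\<close>

lemma empirical_measure_eq_distr:
  assumes "n \<ge> 1" and x: "\<And>i. i \<in> {1..n} \<Longrightarrow> x i \<ge> 0"
  shows "empirical_measure n x = distr (uniform_count_measure {1..n}) nonneg_borel x"
proof (rule measure_eqI)
  fix A assume "A \<in> sets (empirical_measure n x)"
  then have A: "A \<in> sets nonneg_borel"
    by simp
  have x_meas: "x \<in> uniform_count_measure {1..n} \<rightarrow>\<^sub>M nonneg_borel"
    using x by (auto simp: measurable_def space_uniform_count_measure sets_uniform_count_measure)
  have *: "x -` A \<inter> {1..n} = {i \<in> {1..n}. x i \<in> A}"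
    by auto
  have card: "emeasure (uniform_count_measure {1..n}) {i \<in> {1..n}. x i \<in> A} =
      ennreal (real (card {i \<in> {1..n}. x i \<in> A}) / real n)"
    by (subst emeasure_uniform_count_measure) auto
  have "(\<Sum>i=1..n. emeasure (return nonneg_borel (x i)) A) = of_nat (card {i \<in> {1..n}. x i \<in> A})"
    using A by (simp add: sum.If_cases indicator_def Int_def)
  moreover have "emeasure (distr (uniform_count_measure {1..n}) nonneg_borel x) A =
      ennreal (1 / real n) * of_nat (card {i \<in> {1..n}. x i \<in> A})"
    using A x_meas \<open>n \<ge> 1\<close> card
    by (simp add: emeasure_distr space_uniform_count_measure *[unfolded One_nat_def]
        ennreal_of_nat_eq_real_of_nat flip: ennreal_mult)
  ultimately show "emeasure (empirical_measure n x) A =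
      emeasure (distr (uniform_count_measure {1..n}) nonneg_borel x) A"
    using A by (simp add: emeasure_empirical_measure)
qed simp

lemma integral_empirical_measure:
  fixes f :: "real \<Rightarrow> real"
  assumes "n \<ge> 1" and x: "\<And>i. i \<in> {1..n} \<Longrightarrow> x i \<ge> 0" and f: "continuous_on {0..} f"
  shows "(\<integral>y. f y \<partial>empirical_measure n x) = (\<Sum>i=1..n. f (x i)) / real n"
proof -
  have "x \<in> uniform_count_measure {1..n} \<rightarrow>\<^sub>M nonneg_borel"
    using x by (auto simp: measurable_def space_uniform_count_measure sets_uniform_count_measure)
  moreover have "f \<in> borel_measurable nonneg_borel"
    unfolding nonneg_borel_def by (rule borel_measurable_continuous_on_restrict[OF f])
  ultimately show ?thesis
    using empirical_measure_eq_distr[OF assms(1) x]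
    by (simp add: integral_distr integral_uniform_count_measure)
qed

lemma empirical_measure_cong:
  assumes "\<And>i. i \<in> {1..n} \<Longrightarrow> x i = y i"
  shows "empirical_measure n x = empirical_measure n y"
proof -
  have "(\<lambda>A. ennreal (1 / real n) * (\<Sum>i=1..n. emeasure (return nonneg_borel (x i)) A)) =
      (\<lambda>A. ennreal (1 / real n) * (\<Sum>i=1..n. emeasure (return nonneg_borel (y i)) A))"
    using assms by (intro ext arg_cong2[where f = "(*)"] sum.cong) auto
  then show ?thesis
    by (simp add: empirical_measure_def)
qed

text \<open>
  Truncating at \<open>0\<close> makes the map total on \<open>nat \<Rightarrow> real\<close>, whose Borel sets are generated by
  the coordinates; the measurability of a random empirical measure is thereby reduced to
  that of its atoms.
\<close>

lemma continuous_map_empirical_measure: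
  assumes "n \<ge> 1"
  shows "continuous_map euclidean (weak_topology {0..})
    (\<lambda>x. empirical_measure n (\<lambda>i. max 0 (x i)))"
  unfolding weak_topology_def
proof (rule continuous_on_generated_topo)
  let ?E = "\<lambda>x. empirical_measure n (\<lambda>i. max 0 (x i))"
  have E: "?E x \<in> topspace (weak_topology {0..})" for x
    using assms by (intro empirical_measure_in_topspace) auto
  then have E': "?E x \<in> space (prob_algebra (restrict_space borel {0..}))" for x
    by (simp add: topspace_weak_topology space_prob_algebra)
  show "?E ` topspace euclidean \<subseteq>
      \<Union>{{N \<in> space (prob_algebra (restrict_space borel {0..})). (\<integral>x. f x \<partial>N) \<in> U} | f U.
        continuous_on {0..} (f :: real \<Rightarrow> real) \<and> bounded (f ` {0..}) \<and> open U}"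
    using E unfolding weak_topology_def topology_generated_by_topspace by auto
  fix W
  assume "W \<in> {{N \<in> space (prob_algebra (restrict_space borel {0..})). (\<integral>x. f x \<partial>N) \<in> U} | f U.
        continuous_on {0..} (f :: real \<Rightarrow> real) \<and> bounded (f ` {0..}) \<and> open U}"
  then obtain f U where f: "continuous_on {0..} (f :: real \<Rightarrow> real)" and "open U"
    and W: "W = {N \<in> space (prob_algebra (restrict_space borel {0..})). (\<integral>x. f x \<partial>N) \<in> U}"
    by blast
  have "?E -` W \<inter> topspace euclidean = (\<lambda>x. (\<Sum>i=1..n. f (max 0 (x i))) / real n) -` U"
    using assms f E' by (auto simp: W integral_empirical_measure)
  moreover have "continuous_on UNIV (\<lambda>x :: nat \<Rightarrow> real. (\<Sum>i=1..n. f (max 0 (x i))) / real n)"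
    using assms
    by (intro continuous_intros continuous_on_compose2[OF f] continuous_on_product_coordinates) auto
  ultimately show "openin euclidean (?E -` W \<inter> topspace euclidean)"
    using \<open>open U\<close> by (simp add: open_vimage)
qed

lemma empirical_measure_measurable:
  assumes "n \<ge> 1" and meas: "\<And>i. i \<in> {1..n} \<Longrightarrow> y i \<in> borel_measurable M"
    and nonneg: "\<And>i \<omega>. i \<in> {1..n} \<Longrightarrow> \<omega> \<in> space M \<Longrightarrow> 0 \<le> y i \<omega>"
  shows "(\<lambda>\<omega>. empirical_measure n (\<lambda>i. y i \<omega>)) \<in> M \<rightarrow>\<^sub>M borel_sigma (weak_topology {0..})"
proof -
  let ?E = "\<lambda>x. empirical_measure n (\<lambda>i. max 0 (x i))"
  define Y where "Y \<omega> i = (if i \<in> {1..n} then y i \<omega> else 0)" for \<omega> i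
  have Y: "Y \<in> borel_measurable M"
  proof (rule measurable_coordinatewise_then_product)
    show "(\<lambda>\<omega>. Y \<omega> i) \<in> borel_measurable M" for i
      using meas[of i] unfolding Y_def by (cases "i \<in> {1..n}") (simp_all only: if_True if_False borel_measurable_const)
  qed
  have E: "?E \<in> borel \<rightarrow>\<^sub>M borel_sigma (weak_topology {0..})"
    by (rule continuous_map_measurable_borel_sigma_euclidean)
      (rule continuous_map_empirical_measure[OF \<open>n \<ge> 1\<close>])
  have "empirical_measure n (\<lambda>i. y i \<omega>) = ?E (Y \<omega>)" if "\<omega> \<in> space M" for \<omega>
    using that nonneg by (intro empirical_measure_cong) (auto simp: Y_def)
  then show ?thesis
    using measurable_compose[OF Y E] by (simp cong: measurable_cong)
qed

section \<open>Small dilations\<close>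

text \<open>
  On \<open>[0, K]\<close> uniform continuity gives the bound \<open>\<epsilon>\<close>; for \<open>x > K\<close> the trivial bound \<open>2 B\<close> is at most
  \<open>2 B x / K\<close>. Being affine in \<open>x\<close>, the bound can be averaged over a sample of which only the
  mean is known: this is Markov's inequality built into a pointwise estimate.
\<close>

lemma dilation_bound:
  fixes f :: "real \<Rightarrow> real"
  assumes f: "continuous_on {0..} f" and B: "\<And>x. x \<ge> 0 \<Longrightarrow> \<bar>f x\<bar> \<le> B"
    and "\<epsilon> > 0" "K > 0"
  shows "\<exists>\<eta>>0. \<forall>c x. \<bar>c - 1\<bar> < \<eta> \<longrightarrow> c \<ge> 0 \<longrightarrow> x \<ge> 0 \<longrightarrow>
    \<bar>f (c * x) - f x\<bar> \<le> \<epsilon> + 2 * B / K * x"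
proof -
  \<comment> \<open>Factors \<open>c \<le> 2\<close> move \<open>[0, K]\<close> at most into \<open>[0, 2 K]\<close>.\<close>
  have "uniformly_continuous_on {0..2 * K} f"
    by (intro compact_uniformly_continuous continuous_on_subset[OF f]) auto
  then obtain d where "d > 0"
    and d: "\<And>x y. x \<in> {0..2 * K} \<Longrightarrow> y \<in> {0..2 * K} \<Longrightarrow> \<bar>y - x\<bar> < d \<Longrightarrow> \<bar>f y - f x\<bar> < \<epsilon>"
    using \<open>\<epsilon> > 0\<close> unfolding uniformly_continuous_on_def dist_real_def by meson
  have "B \<ge> 0"
    using B[of 0] by simp
  show ?thesis
  proof (intro exI[of _ "min 1 (d / K)"] conjI allI impI)
    show "min 1 (d / K) > 0"
      using \<open>d > 0\<close> \<open>K > 0\<close> by simp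
    fix c x :: real
    assume c: "\<bar>c - 1\<bar> < min 1 (d / K)" and "c \<ge> 0" and "x \<ge> 0"
    show "\<bar>f (c * x) - f x\<bar> \<le> \<epsilon> + 2 * B / K * x"
    proof (cases "x \<le> K")
      case True
      have "c * x \<le> 2 * K"
        using c True \<open>c \<ge> 0\<close> \<open>x \<ge> 0\<close> by (intro mult_mono) auto
      moreover have "\<bar>c * x - x\<bar> < d"
      proof -
        have "\<bar>c * x - x\<bar> = \<bar>c - 1\<bar> * x"
          using abs_mult[of "c - 1" x] \<open>x \<ge> 0\<close> by (simp add: left_diff_distrib)
        also have "\<dots> \<le> \<bar>c - 1\<bar> * K"
          using True by (intro mult_left_mono) auto
        also have "\<dots> < d"
          using c \<open>K > 0\<close> by (simp add: field_simps)
        finally show ?thesis .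
      qed
      ultimately have "\<bar>f (c * x) - f x\<bar> < \<epsilon>"
        using True \<open>c \<ge> 0\<close> \<open>x \<ge> 0\<close> \<open>K > 0\<close> by (intro d) auto
      moreover have "2 * B / K * x \<ge> 0"
        using \<open>B \<ge> 0\<close> \<open>K > 0\<close> \<open>x \<ge> 0\<close> by simp
      ultimately show ?thesis
        by linarith
    next
      case False
      have "\<bar>f (c * x) - f x\<bar> \<le> 2 * B"
        using B[of "c * x"] B[of x] \<open>c \<ge> 0\<close> \<open>x \<ge> 0\<close> by simp
      also have "\<dots> \<le> 2 * B * (x / K)"
        using False \<open>B \<ge> 0\<close> \<open>K > 0\<close> mult_left_mono[of 1 "x / K" "2 * B"] by simp
      finally show ?thesis
        using \<open>\<epsilon> > 0\<close> by simp
    qed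
  qed
qed

text \<open>
  Rescaling a finite sequence with mean \<open>m\<close> close to \<open>\<mu>\<close> so that its mean becomes \<open>\<mu>\<close> hardly
  changes the average of \<open>f\<close> over it, uniformly in the length of the sequence.
\<close>

lemma normalisation_bound:
  fixes f :: "real \<Rightarrow> real"
  assumes f: "continuous_on {0..} f" "bounded (f ` {0..})" and "\<epsilon> > 0" "\<mu> > 0"
  shows "\<exists>\<eta>>0. \<forall>n\<ge>1. \<forall>x :: nat \<Rightarrow> real. (\<forall>i\<in>{1..n}. x i \<ge> 0) \<longrightarrow>
      \<bar>(\<Sum>i=1..n. x i) / real n - \<mu>\<bar> < \<eta> \<longrightarrow>
      \<bar>(\<Sum>i=1..n. f (\<mu> / ((\<Sum>j=1..n. x j) / real n) * x i)) / real n -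
       (\<Sum>i=1..n. f (x i)) / real n\<bar> < \<epsilon>"
proof -
  obtain B where "B > 0" and B: "\<And>x. x \<ge> 0 \<Longrightarrow> \<bar>f x\<bar> \<le> B"
    using f(2) unfolding bounded_pos by auto
  \<comment> \<open>As \<open>m < 2 \<mu>\<close>, the averaged bound \<open>\<epsilon> / 2 + 2 B m / K\<close> is below \<open>\<epsilon>\<close> for this \<open>K\<close>.\<close>
  define K where "K = 8 * B * \<mu> / \<epsilon>"
  have "K > 0"
    using \<open>B > 0\<close> \<open>\<mu> > 0\<close> \<open>\<epsilon> > 0\<close> by (simp add: K_def)
  obtain \<eta> where "\<eta> > 0" and \<eta>: "\<And>c x. \<bar>c - 1\<bar> < \<eta> \<Longrightarrow> c \<ge> 0 \<Longrightarrow> x \<ge> 0 \<Longrightarrow>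
      \<bar>f (c * x) - f x\<bar> \<le> \<epsilon> / 2 + 2 * B / K * x"
    using dilation_bound[OF f(1) B half_gt_zero[OF \<open>\<epsilon> > 0\<close>] \<open>K > 0\<close>] by blast
  show ?thesis
  proof (intro exI[of _ "min (\<mu> / 2) (\<eta> * \<mu> / 2)"] conjI allI impI)
    show "min (\<mu> / 2) (\<eta> * \<mu> / 2) > 0"
      using \<open>\<mu> > 0\<close> \<open>\<eta> > 0\<close> by simp
    fix n :: nat and x :: "nat \<Rightarrow> real"
    assume n: "n \<ge> 1" and x: "\<forall>i\<in>{1..n}. x i \<ge> 0"
    define m where "m = (\<Sum>j=1..n. x j) / real n"
    assume "\<bar>(\<Sum>i=1..n. x i) / real n - \<mu>\<bar> < min (\<mu> / 2) (\<eta> * \<mu> / 2)"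
    then have m: "\<bar>m - \<mu>\<bar> < \<mu> / 2" "\<bar>m - \<mu>\<bar> < \<eta> * \<mu> / 2"
      by (auto simp: m_def)
    then have m_pos: "m > \<mu> / 2" "m < 2 * \<mu>"
      by linarith+
    have "\<bar>m - \<mu>\<bar> < \<eta> * m"
      using m(2) mult_strict_left_mono[OF m_pos(1) \<open>\<eta> > 0\<close>] by simp
    moreover have "\<mu> / m - 1 = (\<mu> - m) / m"
      using m_pos \<open>\<mu> > 0\<close> by (simp add: field_simps)
    ultimately have c: "\<bar>\<mu> / m - 1\<bar> < \<eta>" "\<mu> / m \<ge> 0"
      using m_pos \<open>\<mu> > 0\<close> by (auto simp: abs_minus_commute pos_divide_less_eq)
    have "\<bar>(\<Sum>i=1..n. f (\<mu> / m * x i)) / real n - (\<Sum>i=1..n. f (x i)) / real n\<bar> =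
        \<bar>\<Sum>i=1..n. f (\<mu> / m * x i) - f (x i)\<bar> / real n"
      by (simp only: sum_subtractf diff_divide_distrib[symmetric] abs_divide abs_of_nat)
    also have "\<dots> \<le> (\<Sum>i=1..n. \<epsilon> / 2 + 2 * B / K * x i) / real n"
      using c x by (intro divide_right_mono order_trans[OF sum_abs] sum_mono \<eta>) auto
    also have "\<dots> = \<epsilon> / 2 + 2 * B / K * m"
      using n by (simp add: sum.distrib sum_distrib_left m_def add_divide_distrib)
    also have "\<dots> < \<epsilon> / 2 + 2 * B / K * (2 * \<mu>)"
      using m_pos \<open>B > 0\<close> \<open>K > 0\<close> by (intro add_strict_left_mono mult_strict_left_mono) simp_all
    also have "\<dots> = \<epsilon>"
      using \<open>B > 0\<close> \<open>\<mu> > 0\<close> \<open>\<epsilon> > 0\<close> by (simp add: K_def)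
    finally show "\<bar>(\<Sum>i=1..n. f (\<mu> / ((\<Sum>j=1..n. x j) / real n) * x i)) / real n -
        (\<Sum>i=1..n. f (x i)) / real n\<bar> < \<epsilon>"
      by (simp add: m_def)
  qed
qed

section \<open>Empirical means\<close>

text \<open>
  The distribution function of a point mass at \<open>\<mu>\<close> is continuous at \<open>\<mu> \<plusminus> \<eta> / 2\<close>, with values
  \<open>0\<close> and \<open>1\<close>, and \<open>\<bar>m - \<mu>\<bar> \<ge> \<eta>\<close> forces \<open>m \<le> \<mu> - \<eta> / 2\<close> or \<open>m > \<mu> + \<eta> / 2\<close>. The margin
  \<open>\<eta> / 2\<close> allows for the boundary case \<open>m = \<mu> + \<eta>\<close>.
\<close>

lemma weak_conv_m_return_imp_in_prob:
  fixes m :: "nat \<Rightarrow> 'a \<Rightarrow> real"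
  assumes conv: "weak_conv_m (\<lambda>n. distr (M n) borel (m n)) (return borel \<mu>)"
    and prob: "\<And>n. n \<ge> 1 \<Longrightarrow> prob_space (M n)"
    and meas: "\<And>n. n \<ge> 1 \<Longrightarrow> m n \<in> borel_measurable (M n)"
    and "\<eta> > 0"
  shows "(\<lambda>n. measure (M n) {\<omega> \<in> space (M n). \<eta> \<le> \<bar>m n \<omega> - \<mu>\<bar>}) \<longlonglongrightarrow> 0"
proof -
  let ?cdf = "\<lambda>n. cdf (distr (M n) borel (m n))"
  have cdf_return: "cdf (return borel \<mu>) = indicator {\<mu>..}"
    by (auto simp: cdf_def fun_eq_iff measure_return indicator_def)
  have lim: "(\<lambda>n. ?cdf n y) \<longlonglongrightarrow> indicator {\<mu>..} y" if "y \<noteq> \<mu>" for y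
  proof -
    have "isCont (cdf (return borel \<mu>)) y"
      unfolding cdf_return using that by (simp add: isCont_indicator frontier_real_atLeast)
    then show ?thesis
      using conv unfolding weak_conv_m_def weak_conv_def by (simp add: cdf_return)
  qed
  have "(\<lambda>n. ?cdf n (\<mu> - \<eta> / 2) + (1 - ?cdf n (\<mu> + \<eta> / 2))) \<longlonglongrightarrow>
      indicator {\<mu>..} (\<mu> - \<eta> / 2) + (1 - indicator {\<mu>..} (\<mu> + \<eta> / 2))"
    using \<open>\<eta> > 0\<close> by (intro tendsto_intros lim) auto
  then have "(\<lambda>n. ?cdf n (\<mu> - \<eta> / 2) + (1 - ?cdf n (\<mu> + \<eta> / 2))) \<longlonglongrightarrow> 0"
    using \<open>\<eta> > 0\<close> by simp
  moreover have "\<forall>\<^sub>F n in sequentially. measure (M n) {\<omega> \<in> space (M n). \<eta> \<le> \<bar>m n \<omega> - \<mu>\<bar>} \<le>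
      ?cdf n (\<mu> - \<eta> / 2) + (1 - ?cdf n (\<mu> + \<eta> / 2))"
    using eventually_ge_at_top[of 1]
  proof eventually_elim
    case (elim n)
    interpret prob_space "M n" by (rule prob[OF elim])
    note [measurable] = meas[OF elim]
    have cdf: "?cdf n y = prob {\<omega> \<in> space (M n). m n \<omega> \<le> y}" for y
      by (simp add: cdf_def measure_distr vimage_def Int_def conj_commute)
    have "1 - ?cdf n (\<mu> + \<eta> / 2) = prob {\<omega> \<in> space (M n). \<not> m n \<omega> \<le> \<mu> + \<eta> / 2}"
      unfolding cdf by (subst prob_neg) auto
    moreover have "prob {\<omega> \<in> space (M n). \<eta> \<le> \<bar>m n \<omega> - \<mu>\<bar>} \<le>
        prob ({\<omega> \<in> space (M n). m n \<omega> \<le> \<mu> - \<eta> / 2} \<union> {\<omega> \<in> space (M n). \<not> m n \<omega> \<le> \<mu> + \<eta> / 2})"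
      using \<open>\<eta> > 0\<close> by (intro finite_measure_mono) (auto simp: abs_if split: if_splits)
    ultimately show ?case
      unfolding cdf
      using measure_Un_le[of "{\<omega> \<in> space (M n). m n \<omega> \<le> \<mu> - \<eta> / 2}" "M n"
          "{\<omega> \<in> space (M n). \<not> m n \<omega> \<le> \<mu> + \<eta> / 2}"] by simp
  qed
  ultimately show ?thesis
    by (rule measure_tendsto_zero)
qed

section \<open>The law of large numbers for normalised vectors\<close>

theorem theorem4p1:
  fixes P :: "real measure"
    and \<mu> :: real
    and M :: "nat \<Rightarrow> 'a measure"
    and w p :: "nat \<Rightarrow> nat \<Rightarrow> 'a \<Rightarrow> real"
  assumes "prob_space P" and "sets P = sets nonneg_borel"
    and "integrable P (\<lambda>x. x)" and "\<mu> = (\<integral>x. x \<partial>P)" and "\<mu> \<noteq> 0"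
    and "\<And>n. n \<ge> 1 \<Longrightarrow> prob_space (M n)"
    and "\<And>n i. i \<in> {1..n} \<Longrightarrow> w n i \<in> borel_measurable (M n)"
    and "\<And>n i \<omega>. i \<in> {1..n} \<Longrightarrow> \<omega> \<in> space (M n) \<Longrightarrow> 0 \<le> w n i \<omega>"
    and "LLN_condition M w P"
    and "\<And>n i \<omega>. i \<in> {1..n} \<Longrightarrow> \<omega> \<in> space (M n) \<Longrightarrow>
           p n i \<omega> = w n i \<omega> / (\<Sum>j=1..n. w n j \<omega>)"
  shows "converges_in_law_to_const (weak_topology {0..}) M
           (\<lambda>n \<omega>. empirical_measure n (\<lambda>i. real n * \<mu> * p n i \<omega>)) P"
proof -
  note prob = assms(6) and w_meas = assms(7) and w_nonneg = assms(8)
  have \<mu>: "\<mu> > 0"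
    using assms(4) assms(9) by (simp add: LLN_condition_def)
  obtain Z :: "nat \<Rightarrow> 'a \<Rightarrow> real"
    where Z_meas: "\<And>n. n \<ge> 1 \<Longrightarrow> Z n \<in> borel_measurable (M n)"
      and Z_pos: "\<And>n \<omega>. n \<ge> 1 \<Longrightarrow> \<omega> \<in> space (M n) \<Longrightarrow> 0 < Z n \<omega>"
      and law: "converges_in_law_to_const (weak_topology {0..}) M
          (\<lambda>n \<omega>. empirical_measure n (\<lambda>i. Z n \<omega> * w n i \<omega>)) P"
      and mean: "weak_conv_m
          (\<lambda>n. distr (M n) borel (\<lambda>\<omega>. (1 / real n) * (\<Sum>i=1..n. Z n \<omega> * w n i \<omega>)))
          (return borel \<mu>)"
    using assms(4,9) by (auto simp: LLN_condition_def)
  define x where "x n i \<omega> = Z n \<omega> * w n i \<omega>" for n i \<omega>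
  define m where "m n \<omega> = (\<Sum>i=1..n. x n i \<omega>) / real n" for n \<omega>
  have x_meas: "x n i \<in> borel_measurable (M n)" if "i \<in> {1..n}" for n i
    unfolding x_def using that by (intro borel_measurable_times Z_meas w_meas) auto
  have x_nonneg: "0 \<le> x n i \<omega>" if "i \<in> {1..n}" "\<omega> \<in> space (M n)" for n i \<omega>
    unfolding x_def using that w_nonneg[OF that] Z_pos[of n \<omega>] by simp
  have m_meas: "m n \<in> borel_measurable (M n)" for n
    unfolding m_def using x_meas by (intro borel_measurable_divide borel_measurable_sum) auto
  \<comment> \<open>If all weights vanish, both sides are \<open>0\<close> because \<open>0 / 0 = 0\<close>.\<close>
  have np: "real n * \<mu> * p n i \<omega> = \<mu> / m n \<omega> * x n i \<omega>"
    if "i \<in> {1..n}" "\<omega> \<in> space (M n)" for n i \<omega>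
  proof -
    have "Z n \<omega> > 0"
      using that by (intro Z_pos) auto
    then show ?thesis
      using that by (simp add: assms(10) m_def x_def flip: sum_distrib_left)
  qed
  let ?\<nu> = "\<lambda>n \<omega>. empirical_measure n (\<lambda>i. real n * \<mu> * p n i \<omega>)"
  let ?\<nu>' = "\<lambda>n \<omega>. empirical_measure n (\<lambda>i. x n i \<omega>)"
  have \<nu>_eq: "?\<nu> n \<omega> = empirical_measure n (\<lambda>i. \<mu> / m n \<omega> * x n i \<omega>)"
    if "\<omega> \<in> space (M n)" for n \<omega>
    using np that by (intro empirical_measure_cong) auto
  have m_nonneg: "0 \<le> m n \<omega>" if "\<omega> \<in> space (M n)" for n \<omega>
    unfolding m_def using x_nonneg that by (intro divide_nonneg_nonneg sum_nonneg) auto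
  have scaled_nonneg: "0 \<le> \<mu> / m n \<omega> * x n i \<omega>" if "i \<in> {1..n}" "\<omega> \<in> space (M n)" for n i \<omega>
    using m_nonneg[OF that(2)] x_nonneg[OF that] \<mu> by simp
  have \<nu>_meas: "?\<nu> n \<in> M n \<rightarrow>\<^sub>M borel_sigma (weak_topology {0..})" if "n \<ge> 1" for n
  proof -
    have "(\<lambda>\<omega>. empirical_measure n (\<lambda>i. \<mu> / m n \<omega> * x n i \<omega>))
        \<in> M n \<rightarrow>\<^sub>M borel_sigma (weak_topology {0..})"
      using that m_meas x_meas scaled_nonneg by (intro empirical_measure_measurable) auto
    then show ?thesis
      using \<nu>_eq by (simp cong: measurable_cong)
  qed
  have \<nu>'_meas: "?\<nu>' n \<in> M n \<rightarrow>\<^sub>M borel_sigma (weak_topology {0..})" if "n \<ge> 1" for n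
    using that x_meas x_nonneg by (intro empirical_measure_measurable) auto
  show ?thesis
  proof (rule in_prob_imp_converges_in_law_to_const_weak_topology[OF prob \<nu>_meas])
    show "P \<in> topspace (weak_topology {0..})"
      using law by (simp add: converges_in_law_to_const_def)
    fix f :: "real \<Rightarrow> real" and \<epsilon> :: real
    assume f: "continuous_on {0..} f" "bounded (f ` {0..})" and "\<epsilon> > 0"
    have F: "continuous_map (weak_topology {0..}) euclideanreal (\<lambda>N. \<integral>x. f x \<partial>N)"
      by (rule continuous_map_integral_weak_topology[OF f])
    obtain \<eta> where "\<eta> > 0" and \<eta>: "\<forall>n\<ge>1. \<forall>x :: nat \<Rightarrow> real. (\<forall>i\<in>{1..n}. x i \<ge> 0) \<longrightarrow>
        \<bar>(\<Sum>i=1..n. x i) / real n - \<mu>\<bar> < \<eta> \<longrightarrow>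
        \<bar>(\<Sum>i=1..n. f (\<mu> / ((\<Sum>j=1..n. x j) / real n) * x i)) / real n -
         (\<Sum>i=1..n. f (x i)) / real n\<bar> < \<epsilon> / 2"
      using normalisation_bound[OF f half_gt_zero[OF \<open>\<epsilon> > 0\<close>] \<mu>] by blast
    let ?A = "\<lambda>n. {\<omega> \<in> space (M n). \<eta> \<le> \<bar>m n \<omega> - \<mu>\<bar>}"
    let ?C = "\<lambda>n. {\<omega> \<in> space (M n). \<epsilon> / 2 \<le> \<bar>(\<integral>x. f x \<partial>?\<nu>' n \<omega>) - (\<integral>x. f x \<partial>P)\<bar>}"
    have "(\<lambda>n. measure (M n) (?A n)) \<longlonglongrightarrow> 0"
    proof (rule weak_conv_m_return_imp_in_prob[OF _ prob m_meas \<open>\<eta> > 0\<close>])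
      show "weak_conv_m (\<lambda>n. distr (M n) borel (m n)) (return borel \<mu>)"
        using mean by (simp add: m_def[abs_def] x_def)
    qed
    moreover have "(\<lambda>n. measure (M n) (?C n)) \<longlonglongrightarrow> 0"
      using converges_in_law_to_const_imp_in_prob[OF law prob F, of "\<epsilon> / 2"] \<open>\<epsilon> > 0\<close>
      by (simp add: x_def)
    ultimately have "(\<lambda>n. measure (M n) (?A n) + measure (M n) (?C n)) \<longlonglongrightarrow> 0"
      by (rule tendsto_add_zero)
    moreover have "\<forall>\<^sub>F n in sequentially.
        measure (M n) {\<omega> \<in> space (M n). \<epsilon> \<le> \<bar>(\<integral>x. f x \<partial>?\<nu> n \<omega>) - (\<integral>x. f x \<partial>P)\<bar>}
        \<le> measure (M n) (?A n) + measure (M n) (?C n)"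
      using eventually_ge_at_top[of 1]
    proof eventually_elim
      case (elim n)
      interpret prob_space "M n" by (rule prob[OF elim])
      have [measurable]: "(\<lambda>\<omega>. \<integral>x. f x \<partial>?\<nu>' n \<omega>) \<in> borel_measurable (M n)"
        by (rule measurable_compose[OF \<nu>'_meas[OF elim] continuous_map_measurable_borel_sigma[OF F]])
      note m_meas[measurable]
      have A: "?A n \<in> sets (M n)" and C: "?C n \<in> sets (M n)"
        by measurable
      have close: "\<bar>(\<integral>x. f x \<partial>?\<nu> n \<omega>) - (\<integral>x. f x \<partial>?\<nu>' n \<omega>)\<bar> < \<epsilon> / 2"
        if \<omega>: "\<omega> \<in> space (M n)" "\<bar>m n \<omega> - \<mu>\<bar> < \<eta>" for \<omega>
      proof -
        have "(\<integral>x. f x \<partial>?\<nu> n \<omega>) = (\<Sum>i=1..n. f (\<mu> / m n \<omega> * x n i \<omega>)) / real n"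
          unfolding \<nu>_eq[OF \<omega>(1)] using elim f \<omega> scaled_nonneg
          by (intro integral_empirical_measure)
        moreover have "(\<integral>x. f x \<partial>?\<nu>' n \<omega>) = (\<Sum>i=1..n. f (x n i \<omega>)) / real n"
          using elim f \<omega> x_nonneg by (intro integral_empirical_measure) auto
        ultimately show ?thesis
          using \<eta>[rule_format, of n "\<lambda>i. x n i \<omega>"] elim \<omega> x_nonneg by (simp add: m_def)
      qed
      have "{\<omega> \<in> space (M n). \<epsilon> \<le> \<bar>(\<integral>x. f x \<partial>?\<nu> n \<omega>) - (\<integral>x. f x \<partial>P)\<bar>} \<subseteq> ?A n \<union> ?C n"
      proof
        fix \<omega>
        assume "\<omega> \<in> {\<omega> \<in> space (M n). \<epsilon> \<le> \<bar>(\<integral>x. f x \<partial>?\<nu> n \<omega>) - (\<integral>x. f x \<partial>P)\<bar>}"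
        then have \<omega>: "\<omega> \<in> space (M n)" and
          far: "\<epsilon> \<le> \<bar>(\<integral>x. f x \<partial>?\<nu> n \<omega>) - (\<integral>x. f x \<partial>P)\<bar>"
          by auto
        show "\<omega> \<in> ?A n \<union> ?C n"
        proof (cases "\<bar>m n \<omega> - \<mu>\<bar> < \<eta>")
          case True
          have "\<epsilon> / 2 \<le> \<bar>(\<integral>x. f x \<partial>?\<nu>' n \<omega>) - (\<integral>x. f x \<partial>P)\<bar>"
            using close[OF \<omega> True] far by linarith
          with \<omega> show ?thesis
            by simp
        next
          case False
          with \<omega> show ?thesis
            by simp
        qed
      qed
      then have "measure (M n) {\<omega> \<in> space (M n). \<epsilon> \<le> \<bar>(\<integral>x. f x \<partial>?\<nu> n \<omega>) - (\<integral>x. f x \<partial>P)\<bar>}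
          \<le> measure (M n) (?A n \<union> ?C n)"
        using A C by (intro finite_measure_mono) auto
      also have "\<dots> \<le> measure (M n) (?A n) + measure (M n) (?C n)"
        using A C by (rule measure_Un_le)
      finally show ?case .
    qed
    ultimately show "(\<lambda>n. measure (M n)
        {\<omega> \<in> space (M n). \<epsilon> \<le> \<bar>(\<integral>x. f x \<partial>?\<nu> n \<omega>) - (\<integral>x. f x \<partial>P)\<bar>}) \<longlonglongrightarrow> 0"
      by (rule measure_tendsto_zero)
  qed
qed

end
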